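(* Let $\Omega\subset\mathbb{R}^d$ ($d\ge1$) be a bounded domain and $\mu$ a positive finite Borel measure on $\mathbb{R}^d$ with $\operatorname{supp}(\mu)\subset\overline\Omega$ and $\mu(\Omega)>0$, and assume (MPI) holds. If $u\in C(\Omega)$ is a nonconstant $\mu$-subharmonic function, then $u$ cannot attain its maximum value in $\Omega$.
   Context: (MPI): there is $C>0$ with $\int_\Omega|u|^2\,d\mu\le C\int_\Omega|\nabla u|^2\,d\boldsymbol{x}$ for all $u\in C_c^\infty(\Omega)$. Under (MPI), each $u\in H_0^1(\Omega)$ has a unique $L^2(\Omega,\mu)$-representative $\mathcal I(u)$ (the $L^2(\mu)$-limit of any $C_c^\infty(\Omega)$ sequence converging to $u$ in $H_0^1$); let $\mathcal N=\{u\in H_0^1(\Omega):\mathcal I(u)=0\text{ in }L^2(\mu)\}$ and $\mathcal N^\perp$ its orthogonal complement in $H_0^1(\Omega)$. The operator $\Delta_\mu$ is defined by: $u\in\operatorname{Dom}(\Delta_\mu)$ and $-\Delta_\mu u=f$ iff $u\in\mathcal N^\perp$, $f\in L^2(\Omega,\mu)$, and $\int_\Omega\nabla u\cdot\nabla\varphi\,d\boldsymbol{x}=\int_\Omega f\varphi\,d\mu$ for all $\varphi\in C_c^\infty(\Omega)$. A function $u\in\operatorname{Dom}(\Delta_\mu)$ is $\mu$-subharmonic if $\Delta_\mu u\ge0$ $\mu$-a.e. *)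

theory Defs
  imports "HOL-Analysis.Analysis"
begin

definition grad :: "('a::euclidean_space \<Rightarrow> real) \<Rightarrow> 'a \<Rightarrow> 'a" where
  "grad f x = (\<Sum>b\<in>Basis. frechet_derivative f (at x) b *\<^sub>R b)"

coinductive smooth_fun :: "('a::euclidean_space \<Rightarrow> real) \<Rightarrow> bool" where
  "\<lbrakk> \<forall>x. f differentiable (at x);
     \<forall>b\<in>Basis. smooth_fun (\<lambda>x. frechet_derivative f (at x) b) \<rbrakk> \<Longrightarrow> smooth_fun f"

text \<open>Test functions C_c^infinity(Omega) (extended by zero to R^d).\<close>
definition test_fun :: "'a::euclidean_space set \<Rightarrow> ('a \<Rightarrow> real) \<Rightarrow> bool" where
  "test_fun \<Omega> \<phi> \<longleftrightarrow> smooth_fun \<phi> \<and> compact (closure {x. \<phi> x \<noteq> 0})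
      \<and> closure {x. \<phi> x \<noteq> 0} \<subseteq> \<Omega>"

definition measure_support :: "'a::metric_space measure \<Rightarrow> 'a set" where
  "measure_support \<mu> = {x. \<forall>e>0. emeasure \<mu> (ball x e) > 0}"

definition H01_approx :: "'a::euclidean_space set \<Rightarrow> ('a \<Rightarrow> real) \<Rightarrow> ('a \<Rightarrow> 'a)
    \<Rightarrow> (nat \<Rightarrow> 'a \<Rightarrow> real) \<Rightarrow> bool" where
  "H01_approx \<Omega> u g \<phi> \<longleftrightarrow> (\<forall>n. test_fun \<Omega> (\<phi> n))
     \<and> (\<lambda>n. \<integral>\<^sup>+ x\<in>\<Omega>. ennreal ((\<phi> n x - u x)^2) \<partial>lebesgue) \<longlonglongrightarrow> 0
     \<and> (\<lambda>n. \<integral>\<^sup>+ x\<in>\<Omega>. ennreal ((norm (grad (\<phi> n) x - g x))^2) \<partial>lebesgue) \<longlonglongrightarrow> 0"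

text \<open>u is (a representative of) an element of H_0^1(Omega) with weak gradient g.\<close>
definition H01 :: "'a::euclidean_space set \<Rightarrow> ('a \<Rightarrow> real) \<Rightarrow> ('a \<Rightarrow> 'a) \<Rightarrow> bool" where
  "H01 \<Omega> u g \<longleftrightarrow> set_borel_measurable lebesgue \<Omega> u \<and> set_borel_measurable lebesgue \<Omega> g
     \<and> (\<exists>\<phi>. H01_approx \<Omega> u g \<phi>)"

definition MPI :: "'a::euclidean_space set \<Rightarrow> 'a measure \<Rightarrow> bool" where
  "MPI \<Omega> \<mu> \<longleftrightarrow> (\<exists>C>0. \<forall>\<phi>. test_fun \<Omega> \<phi> \<longrightarrow>
      (\<integral>x. (\<phi> x)^2 \<partial>\<mu>) \<le> C * (LINT x:\<Omega>|lebesgue. (norm (grad \<phi> x))^2))"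

text \<open>w is (a representative of) I(u): the L^2(mu)-limit of a C_c^infinity sequence
  converging to u in H_0^1.\<close>
definition mu_trace :: "'a::euclidean_space set \<Rightarrow> 'a measure \<Rightarrow> ('a \<Rightarrow> real) \<Rightarrow> ('a \<Rightarrow> 'a)
    \<Rightarrow> ('a \<Rightarrow> real) \<Rightarrow> bool" where
  "mu_trace \<Omega> \<mu> u g w \<longleftrightarrow> w \<in> borel_measurable \<mu> \<and>
     (\<exists>\<phi>. H01_approx \<Omega> u g \<phi> \<and> (\<lambda>n. \<integral>\<^sup>+ x. ennreal ((\<phi> n x - w x)^2) \<partial>\<mu>) \<longlonglongrightarrow> 0)"

text \<open>u belongs to the orthogonal complement of N = ker I in H_0^1(Omega), with respect to
  the inner product (u,v) = integral over Omega of grad u . grad v.\<close>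
definition N_perp :: "'a::euclidean_space set \<Rightarrow> 'a measure \<Rightarrow> ('a \<Rightarrow> real) \<Rightarrow> ('a \<Rightarrow> 'a) \<Rightarrow> bool" where
  "N_perp \<Omega> \<mu> u g \<longleftrightarrow> H01 \<Omega> u g \<and>
     (\<forall>v gv. H01 \<Omega> v gv \<and> mu_trace \<Omega> \<mu> v gv (\<lambda>_. 0) \<longrightarrow>
        (LINT x:\<Omega>|lebesgue. g x \<bullet> gv x) = 0)"

definition minus_laplacian_mu :: "'a::euclidean_space set \<Rightarrow> 'a measure \<Rightarrow> ('a \<Rightarrow> real)
    \<Rightarrow> ('a \<Rightarrow> real) \<Rightarrow> bool" where
  "minus_laplacian_mu \<Omega> \<mu> u f \<longleftrightarrow> (\<exists>g. N_perp \<Omega> \<mu> u g \<and>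
     f \<in> borel_measurable \<mu> \<and> integrable \<mu> (\<lambda>x. (f x)^2) \<and>
     (\<forall>\<phi>. test_fun \<Omega> \<phi> \<longrightarrow>
        (LINT x:\<Omega>|lebesgue. g x \<bullet> grad \<phi> x) = (\<integral>x. f x * \<phi> x \<partial>\<mu>)))"

definition mu_subharmonic :: "'a::euclidean_space set \<Rightarrow> 'a measure \<Rightarrow> ('a \<Rightarrow> real) \<Rightarrow> bool" where
  "mu_subharmonic \<Omega> \<mu> u \<longleftrightarrow> (\<exists>f. minus_laplacian_mu \<Omega> \<mu> u f \<and> (AE x in \<mu>. - f x \<ge> 0))"

end

theory Submission
  imports Defs
begin

text \<open>If \<open>u\<close> attains its maximum \<open>M\<close>, then \<open>w = M - u\<close> is nonnegative, continuous and weakly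
  superharmonic: moving both derivatives onto a test function \<open>\<eta> \<ge> 0\<close> gives
  \<open>\<integral> w \<Delta>\<eta> \<le> 0\<close>, and this sign is all that is needed of \<open>\<mu>\<close>. Around a zero \<open>c\<close> of \<open>w\<close>, the means of
  \<open>w\<close> against radial bumps shrinking to \<open>c\<close> tend to \<open>w c = 0\<close>, and they are nonincreasing in
  the radius because the radius derivative of a normalised bump is a positive multiple of the
  Laplacian of another bump. So \<open>w\<close> vanishes near \<open>c\<close>, the zero set of \<open>w\<close> is open and closed,
  and \<open>u\<close> is constant.\<close>

abbreviation pd :: "'a::real_normed_vector \<Rightarrow> ('a \<Rightarrow> real) \<Rightarrow> 'a \<Rightarrow> real" where
  "pd b f x \<equiv> frechet_derivative f (at x) b"

section \<open>Smooth functions\<close>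

lemma smooth_fun_differentiable: "smooth_fun f \<Longrightarrow> f differentiable (at x)"
  by (erule smooth_fun.cases) simp

lemma smooth_fun_pd: "smooth_fun f \<Longrightarrow> b \<in> Basis \<Longrightarrow> smooth_fun (pd b f)"
  by (erule smooth_fun.cases) simp

lemma smooth_fun_continuous: "smooth_fun f \<Longrightarrow> continuous_on S f"
  by (meson continuous_at_imp_continuous_on differentiable_imp_continuous_within
      smooth_fun_differentiable)

lemma inner_grad: "grad f x \<bullet> grad h x = (\<Sum>b\<in>Basis. pd b f x * pd b h x)"
proof -
  have "grad f x \<bullet> b = pd b f x" if "b \<in> Basis" for f b
    using that by (simp add: grad_def inner_sum_left inner_Basis if_distrib sum.delta cong: if_cong)
  then show ?thesis
    by (subst euclidean_inner) simp
qed

lemma continuous_on_grad: "smooth_fun f \<Longrightarrow> continuous_on S (grad f)"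
  unfolding grad_def
  by (intro continuous_intros smooth_fun_continuous smooth_fun_pd)

text \<open>Since \<open>T\<close> is closed, \<open>f\<close> agrees with the zero function on a
  whole neighbourhood of \<open>x\<close>, and this determines the derivative at
  \<open>x\<close>.\<close>

lemma pd_eq_0_outside:
  assumes "closed T" and "\<And>x. x \<notin> T \<Longrightarrow> f x = 0" and "x \<notin> T"
  shows "pd b f x = 0"
proof -
  have "((\<lambda>_. 0) has_derivative (\<lambda>_. 0)) (at x)" by simp
  then have "(f has_derivative (\<lambda>_. 0)) (at x)"
    by (rule has_derivative_transform_within_open[where s="- T"]) (use assms in auto)
  then show ?thesis
    using frechet_derivative_at by metis
qed

lemma compact_support_bounded:
  fixes f :: "'a::euclidean_space \<Rightarrow> 'b::real_normed_vector"
  assumes "continuous_on UNIV f" "compact T" "\<And>x. x \<notin> T \<Longrightarrow> f x = 0"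
  obtains B where "B \<ge> 0" "\<And>x. norm (f x) \<le> B"
proof -
  have "compact (f ` T)"
    using assms by (intro compact_continuous_image) (auto intro: continuous_on_subset)
  then obtain B where B: "\<And>x. x \<in> T \<Longrightarrow> norm (f x) \<le> B"
    by (force simp: bounded_iff dest: compact_imp_bounded)
  have "norm (f x) \<le> max B 0" for x
    using B[of x] assms(3)[of x] by (cases "x \<in> T") auto
  then show ?thesis
    by (intro that[of "max B 0"]) auto
qed

section \<open>Integration by parts\<close>

text \<open>The integral of \<open>x \<mapsto> F (x + t b)\<close> does not depend on \<open>t\<close>; differentiate at \<open>t = 0\<close>.\<close>

lemma has_integral_directional_derivative:
  fixes F G :: "'a::euclidean_space \<Rightarrow> real"
  assumes der: "\<And>x. ((\<lambda>t. F (x + t *\<^sub>R b)) has_real_derivative G x) (at 0)"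
    and F: "continuous_on UNIV F" and G: "continuous_on UNIV G"
    and T: "compact T" "\<And>x. x \<notin> T \<Longrightarrow> F x = 0" "\<And>x. x \<notin> T \<Longrightarrow> G x = 0" "T \<subseteq> S"
  shows "(G has_integral 0) S"
proof -
  \<comment> \<open>The box contains \<open>T\<close> thickened by the length of \<open>b\<close>.
    For |t| \<le> 1 the support of the translate by \<open>t b\<close> thus stays inside one fixed
    domain of integration.\<close>
  have "bounded {x + y |x y. x \<in> T \<and> y \<in> cball 0 (norm b)}"
    by (intro compact_imp_bounded compact_sums T compact_cball)
  then obtain a where a: "{x + y |x y. x \<in> T \<and> y \<in> cball 0 (norm b)} \<subseteq> cbox (-a) a"
    by (rule bounded_subset_cbox_symmetric)
  let ?C = "cbox (-a) a"
  have inC: "x \<in> ?C" if "x + t *\<^sub>R b \<in> T" "\<bar>t\<bar> \<le> 1" for x t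
  proof -
    have "norm (- t *\<^sub>R b) \<le> norm b"
      using that(2) by (simp add: mult_left_le_one_le)
    moreover have "x = (x + t *\<^sub>R b) + (- t *\<^sub>R b)" by simp
    ultimately have "x \<in> {x + y |x y. x \<in> T \<and> y \<in> cball 0 (norm b)}"
      using that(1) by (metis (mono_tags, lifting) mem_Collect_eq mem_cball_0)
    then show ?thesis using a by blast
  qed
  have TC: "T \<subseteq> ?C"
    using inC[where t=0] by auto
  have shift: "((\<lambda>t. F (x + t *\<^sub>R b)) has_real_derivative G (x + t *\<^sub>R b)) (at t)" for x t
  proof -
    have "((\<lambda>s. F ((x + t *\<^sub>R b) + s *\<^sub>R b)) has_real_derivative G (x + t *\<^sub>R b)) (at (t - t))"
      using der[of "x + t *\<^sub>R b"] by simp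
    from DERIV_shift[THEN iffD1, of _ _ t "-t"] this
    have "((\<lambda>s. F ((x + t *\<^sub>R b) + (s + - t) *\<^sub>R b)) has_real_derivative G (x + t *\<^sub>R b)) (at t)"
      by simp
    then show ?thesis by (simp add: algebra_simps)
  qed
  let ?U = "{-1<..<1::real}"
  have lr: "((\<lambda>t. integral ?C (\<lambda>x. F (x + t *\<^sub>R b))) has_real_derivative
      integral ?C (\<lambda>x. G (x + 0 *\<^sub>R b))) (at 0 within ?U)"
  proof (rule leibniz_rule_field_derivative[where fx="\<lambda>t x. G (x + t *\<^sub>R b)"])
    show "(\<lambda>x. F (x + t *\<^sub>R b)) integrable_on ?C" for t
      by (intro integrable_continuous continuous_intros continuous_on_compose2[OF F]) auto
    show "continuous_on (?U \<times> ?C) (\<lambda>(t, x). G (x + t *\<^sub>R b))"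
      unfolding case_prod_unfold
      by (intro continuous_intros continuous_on_compose2[OF G]) auto
  qed (auto intro: DERIV_subset shift)
  \<comment> \<open>Both the shifted box and \<open>?C\<close> contain the support of the translate,
    so both integrals equal the one over the whole space. On the shifted box a change of variables
    removes \<open>t\<close>.\<close>
  have const: "integral ?C (\<lambda>x. F (x + t *\<^sub>R b)) = integral ?C F" if "t \<in> ?U" for t
  proof -
    have int: "((\<lambda>x. F (x + t *\<^sub>R b)) has_integral integral (cbox p q) (\<lambda>x. F (x + t *\<^sub>R b))) UNIV"
      if "\<And>x. x + t *\<^sub>R b \<in> T \<Longrightarrow> x \<in> cbox p q" for p q
      by (rule has_integral_on_superset[OF integrable_integral])
        (use that T in \<open>auto intro!: integrable_continuous continuous_intros continuous_on_compose2[OF F]\<close>)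
    have "((\<lambda>x. F (x + t *\<^sub>R b)) has_integral integral (cbox (-a - t *\<^sub>R b) (a - t *\<^sub>R b)) (\<lambda>x. F (x + t *\<^sub>R b))) UNIV"
    proof (rule int)
      fix x assume "x + t *\<^sub>R b \<in> T"
      then have "x + t *\<^sub>R b \<in> ?C" using TC by auto
      then show "x \<in> cbox (-a - t *\<^sub>R b) (a - t *\<^sub>R b)"
        by (auto simp: mem_box algebra_simps)
    qed
    moreover have "((\<lambda>x. F (x + t *\<^sub>R b)) has_integral integral ?C (\<lambda>x. F (x + t *\<^sub>R b))) UNIV"
      by (rule int) (use inC that in auto)
    ultimately show ?thesis
      unfolding integral_shift_cbox by (rule has_integral_unique[symmetric])
  qed
  have "((\<lambda>t. integral ?C F) has_real_derivative integral ?C G) (at 0 within ?U)"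
  proof (rule has_field_derivative_transform_within[OF _ zero_less_one])
    show "((\<lambda>t. integral ?C (\<lambda>x. F (x + t *\<^sub>R b))) has_real_derivative integral ?C G) (at 0 within ?U)"
      using lr by simp
  qed (simp_all only: const, simp)
  then have "((\<lambda>t. integral ?C F) has_real_derivative integral ?C G) (at 0)"
    by (subst (asm) at_within_open) auto
  then have "integral ?C G = 0"
    by (rule DERIV_unique[OF _ DERIV_const])
  moreover have "G integrable_on ?C"
    by (rule integrable_continuous) (rule continuous_on_subset[OF G], simp)
  ultimately have "(G has_integral 0) ?C"
    using integrable_integral by force
  then have "(G has_integral 0) UNIV"
    by (rule has_integral_on_superset) (use T(3) TC in auto)
  then have "((\<lambda>x. if x \<in> S then G x else 0) has_integral 0) UNIV"
    by (rule has_integral_eq[rotated]) (use T in auto)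
  then show ?thesis
    by (simp add: has_integral_restrict_UNIV)
qed

section \<open>The Laplacian and Green's identity for test functions\<close>

definition laplacian :: "('a::euclidean_space \<Rightarrow> real) \<Rightarrow> 'a \<Rightarrow> real" where
  "laplacian f x = (\<Sum>b\<in>Basis. pd b (pd b f) x)"

lemma continuous_on_laplacian: "smooth_fun f \<Longrightarrow> continuous_on S (laplacian f)"
  unfolding laplacian_def
  by (intro continuous_intros smooth_fun_continuous smooth_fun_pd)

text \<open>Partial derivatives of constants are again constant, so the class of all constants is a
  coinduction invariant.\<close>

lemma smooth_fun_const: "smooth_fun (\<lambda>_. c)"
proof -
  have "\<exists>c. (\<lambda>_. c) = (\<lambda>_. c :: real)" for c :: real by blast
  then show ?thesis
    by (coinduction arbitrary: c) auto
qed

lemma test_fun_smooth: "test_fun \<Omega> \<phi> \<Longrightarrow> smooth_fun \<phi>"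
  by (simp add: test_fun_def)

text \<open>Differentiation does not enlarge the closed support, so one compact set serves for
  \<open>\<phi>\<close> and all the derivatives that occur later.\<close>

lemma test_fun_support:
  assumes "test_fun \<Omega> \<phi>"
  obtains T where "compact T" "T \<subseteq> \<Omega>" "\<And>x. x \<notin> T \<Longrightarrow> \<phi> x = 0"
    "\<And>x. x \<notin> T \<Longrightarrow> grad \<phi> x = 0" "\<And>b x. x \<notin> T \<Longrightarrow> pd b \<phi> x = 0"
    "\<And>b x. x \<notin> T \<Longrightarrow> pd b (pd b \<phi>) x = 0" "\<And>x. x \<notin> T \<Longrightarrow> laplacian \<phi> x = 0"
proof -
  let ?T = "closure {x. \<phi> x \<noteq> 0}"
  have T: "compact ?T" "?T \<subseteq> \<Omega>"
    using assms by (auto simp: test_fun_def)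
  have 0: "\<phi> x = 0" if "x \<notin> ?T" for x
    using that closure_subset[of "{x. \<phi> x \<noteq> 0}"] by blast
  have 1: "pd b \<phi> x = 0" if "x \<notin> ?T" for b x
    by (rule pd_eq_0_outside[OF closed_closure 0 that])
  have 2: "pd b (pd b \<phi>) x = 0" if "x \<notin> ?T" for b x
    by (rule pd_eq_0_outside[OF closed_closure 1 that])
  show ?thesis
  proof (rule that[OF T 0 _ 1 2])
    show "grad \<phi> x = 0" "laplacian \<phi> x = 0" if "x \<notin> ?T" for x
      by (simp_all only: grad_def laplacian_def 1[OF that] 2[OF that] scaleR_zero_left sum.neutral_const)
  qed
qed

text \<open>The integrand is the divergence of \<open>\<phi>\<close> times the gradient of
  \<open>\<eta>\<close>. Compact support of \<open>\<eta>\<close> makes this field compactly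
  supported, so each coordinate contributes zero, even when \<open>\<phi>\<close> is a
  constant.\<close>

lemma has_integral_by_parts:
  assumes \<phi>: "smooth_fun \<phi>" and \<eta>: "test_fun \<Omega> \<eta>"
  shows "((\<lambda>x. grad \<phi> x \<bullet> grad \<eta> x + \<phi> x * laplacian \<eta> x) has_integral 0) \<Omega>"
proof -
  obtain T where T: "compact T" "T \<subseteq> \<Omega>" "\<And>b x. x \<notin> T \<Longrightarrow> pd b \<eta> x = 0"
    "\<And>b x. x \<notin> T \<Longrightarrow> pd b (pd b \<eta>) x = 0"
    using test_fun_support[OF \<eta>] by metis
  note sm = \<phi> test_fun_smooth[OF \<eta>]
  \<comment> \<open>Restriction to a line turns the Frechet derivative into the one-variable
    derivative that the directional lemma expects.\<close>
  have line: "((\<lambda>t. f (x + t *\<^sub>R b)) has_real_derivative pd b f x) (at 0)"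
    if "smooth_fun f" for f :: "'a \<Rightarrow> real" and x b
  proof -
    have f: "(f has_derivative frechet_derivative f (at x)) (at x)"
      using smooth_fun_differentiable[OF that] frechet_derivative_works by blast
    have "((\<lambda>t. x + t *\<^sub>R b) has_derivative (\<lambda>t. t *\<^sub>R b)) (at 0)"
      by (auto intro!: derivative_eq_intros)
    from has_derivative_compose[OF this, of f] f
    have "((\<lambda>t. f (x + t *\<^sub>R b)) has_derivative (\<lambda>t. frechet_derivative f (at x) (t *\<^sub>R b))) (at 0)"
      by simp
    moreover have "frechet_derivative f (at x) (t *\<^sub>R b) = pd b f x * t" for t
      using linear_scale[OF has_derivative_linear[OF f]] by simp
    ultimately show ?thesis
      by (simp add: has_field_derivative_def)
  qed
  have "((\<lambda>x. pd b \<phi> x * pd b \<eta> x + \<phi> x * pd b (pd b \<eta>) x) has_integral 0) \<Omega>"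
    if b: "b \<in> Basis" for b
  proof (rule has_integral_directional_derivative[where F="\<lambda>x. \<phi> x * pd b \<eta> x" and b=b and T=T])
    show "((\<lambda>t. \<phi> (x + t *\<^sub>R b) * pd b \<eta> (x + t *\<^sub>R b)) has_real_derivative
        pd b \<phi> x * pd b \<eta> x + \<phi> x * pd b (pd b \<eta>) x) (at 0)" for x
      using DERIV_mult[OF line[OF \<phi>, of x b] line[OF smooth_fun_pd[OF sm(2) b], of x b]]
      by (simp add: mult.commute)
    show "continuous_on UNIV (\<lambda>x. \<phi> x * pd b \<eta> x)"
      "continuous_on UNIV (\<lambda>x. pd b \<phi> x * pd b \<eta> x + \<phi> x * pd b (pd b \<eta>) x)"
      by (intro continuous_intros smooth_fun_continuous smooth_fun_pd sm b)+
  qed (use T in auto)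
  then have "((\<lambda>x. \<Sum>b\<in>Basis. pd b \<phi> x * pd b \<eta> x + \<phi> x * pd b (pd b \<eta>) x) has_integral 
      (\<Sum>b\<in>(Basis::'a set). 0)) \<Omega>"
    by (intro has_integral_sum) auto
  then show ?thesis
    by (simp add: inner_grad laplacian_def sum.distrib sum_distrib_left)
qed

text \<open>Green's identity with \<open>\<phi>\<close> = 1. It allows \<open>u\<close> to be
  replaced by \<open>M - u\<close>, since the constant contributes nothing.\<close>

lemma has_integral_laplacian:
  assumes "test_fun \<Omega> \<eta>"
  shows "(laplacian \<eta> has_integral 0) \<Omega>"
proof -
  have "grad (\<lambda>_. 1) x = 0" for x :: 'a
    by (simp add: grad_def)
  then show ?thesis
    using has_integral_by_parts[OF smooth_fun_const[of 1] assms] by simp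
qed

section \<open>The weak Laplacian of an H01 function\<close>

text \<open>On a finite measure space L2 convergence implies L1 convergence, by Cauchy-Schwarz
  against the constant 1, and a bounded factor \<open>\<psi>\<close> preserves it. The vector-valued
  form covers both gradients and real functions, where the inner product is multiplication.\<close>

lemma tendsto_integral_inner_of_L2:
  fixes f :: "nat \<Rightarrow> 'a \<Rightarrow> 'b::euclidean_space"
  assumes M: "finite_measure M"
    and [measurable]: "\<And>n. f n \<in> borel_measurable M" "g \<in> borel_measurable M"
      "\<psi> \<in> borel_measurable M"
    and lim: "(\<lambda>n. \<integral>\<^sup>+ x. ennreal ((norm (f n x - g x))\<^sup>2) \<partial>M) \<longlonglongrightarrow> 0"
    and B: "B \<ge> 0" "\<And>x. norm (\<psi> x) \<le> B"
    and int: "\<And>n. integrable M (\<lambda>x. f n x \<bullet> \<psi> x)"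
  shows "integrable M (\<lambda>x. g x \<bullet> \<psi> x)"
    and "(\<lambda>n. \<integral>x. f n x \<bullet> \<psi> x \<partial>M) \<longlonglongrightarrow> (\<integral>x. g x \<bullet> \<psi> x \<partial>M)"
proof -
  define s where "s n = (\<integral>\<^sup>+ x. ennreal (norm (f n x - g x)) \<partial>M)" for n
  have "(s n)\<^sup>2 \<le> (\<integral>\<^sup>+ x. ennreal ((norm (f n x - g x))\<^sup>2) \<partial>M) * emeasure M (space M)" for n
  proof -
    have "(s n)\<^sup>2 \<le> (\<integral>\<^sup>+ x. (ennreal (norm (f n x - g x)))\<^sup>2 \<partial>M) * (\<integral>\<^sup>+ x. 1\<^sup>2 \<partial>M)"
      using Cauchy_Schwarz_nn_integral[of "\<lambda>x. ennreal (norm (f n x - g x))" M "\<lambda>_. 1"]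
      unfolding s_def by simp
    then show ?thesis
      by (simp only: ennreal_power norm_ge_zero power_one nn_integral_const mult_1_left)
  qed
  moreover have "(\<lambda>n. (\<integral>\<^sup>+ x. ennreal ((norm (f n x - g x))\<^sup>2) \<partial>M) * emeasure M (space M)) \<longlonglongrightarrow> 0"
  proof -
    have "emeasure M (space M) < top"
      using finite_measure.emeasure_finite[OF M] by (simp add: top.not_eq_extremum)
    from ennreal_tendsto_cmult[OF this lim] show ?thesis
      by (simp only: mult_zero_left mult_zero_right mult.commute)
  qed
  ultimately have sq: "(\<lambda>n. (s n)\<^sup>2) \<longlonglongrightarrow> 0"
    by (rule tendsto_sandwich[OF always_eventually[OF allI[OF zero_le]] always_eventually[OF allI]
        tendsto_const])
  have s: "s \<longlonglongrightarrow> 0"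
  proof (rule order_tendstoI)
    fix a :: ennreal assume "0 < a"
    then have "0 < a\<^sup>2" by (simp add: power2_eq_square ennreal_zero_less_mult_iff)
    then have "eventually (\<lambda>n. (s n)\<^sup>2 < a\<^sup>2) sequentially"
      by (rule order_tendstoD(2)[OF sq])
    then show "eventually (\<lambda>n. s n < a) sequentially"
      by eventually_elim (meson not_le power_mono zero_le)
  qed simp
  have le: "(\<integral>\<^sup>+ x. norm (f n x \<bullet> \<psi> x - g x \<bullet> \<psi> x) \<partial>M) \<le> ennreal B * s n" for n
  proof -
    have "norm (f n x \<bullet> \<psi> x - g x \<bullet> \<psi> x) \<le> B * norm (f n x - g x)" for x
    proof -
      have "norm (f n x \<bullet> \<psi> x - g x \<bullet> \<psi> x) \<le> norm (f n x - g x) * norm (\<psi> x)"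
        by (metis Cauchy_Schwarz_ineq2 inner_diff_left real_norm_def)
      also have "\<dots> \<le> norm (f n x - g x) * B"
        by (intro mult_left_mono B) simp
      finally show ?thesis by (simp add: mult.commute)
    qed
    then have "(\<integral>\<^sup>+ x. norm (f n x \<bullet> \<psi> x - g x \<bullet> \<psi> x) \<partial>M) \<le> (\<integral>\<^sup>+ x. ennreal B * norm (f n x - g x) \<partial>M)"
      using B(1) by (intro nn_integral_mono) (simp add: ennreal_mult[symmetric] del: real_norm_def)
    then show ?thesis
      by (simp add: nn_integral_cmult s_def)
  qed
  have L1: "(\<lambda>n. \<integral>\<^sup>+ x. norm (f n x \<bullet> \<psi> x - g x \<bullet> \<psi> x) \<partial>M) \<longlonglongrightarrow> 0"
  proof (rule tendsto_sandwich[OF _ _ tendsto_const])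
    show "(\<lambda>n. ennreal B * s n) \<longlonglongrightarrow> 0"
      using ennreal_tendsto_cmult[OF ennreal_less_top s, of B] by (simp only: mult_zero_right)
  qed (intro always_eventually allI le zero_le)+
  \<comment> \<open>A single index at finite L1 distance makes the limit integrable, as a difference
    of two integrable functions.\<close>
  then have "eventually (\<lambda>n. (\<integral>\<^sup>+ x. norm (f n x \<bullet> \<psi> x - g x \<bullet> \<psi> x) \<partial>M) < 1) sequentially"
    by (rule order_tendstoD) simp
  from eventually_happens'[OF sequentially_bot this]
  obtain n where n: "(\<integral>\<^sup>+ x. norm (f n x \<bullet> \<psi> x - g x \<bullet> \<psi> x) \<partial>M) < 1" ..
  have "integrable M (\<lambda>x. f n x \<bullet> \<psi> x - g x \<bullet> \<psi> x)"
  proof (rule integrableI_bounded)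
    show "(\<integral>\<^sup>+ x. norm (f n x \<bullet> \<psi> x - g x \<bullet> \<psi> x) \<partial>M) < \<infinity>"
      using n by (rule order_less_trans) simp
  qed measurable
  from Bochner_Integration.integrable_diff[OF int[of n] this]
  show g: "integrable M (\<lambda>x. g x \<bullet> \<psi> x)" by simp
  show "(\<lambda>n. \<integral>x. f n x \<bullet> \<psi> x \<partial>M) \<longlonglongrightarrow> (\<integral>x. g x \<bullet> \<psi> x \<partial>M)"
    by (rule tendsto_L1_int[OF int g L1])
qed

text \<open>Green's identity holds for each approximating test function. The L2 limits of values and
  of gradients are then taken separately, against the bounded functions
  \<open>laplacian \<eta>\<close> and \<open>grad \<eta>\<close>; boundedness of \<Omega> makes the
  measure finite.\<close>

lemma H01_weak_laplacian:
  fixes \<Omega> :: "'a::euclidean_space set"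
  assumes \<Omega>: "open \<Omega>" "bounded \<Omega>" and H: "H01 \<Omega> u g" and \<eta>: "test_fun \<Omega> \<eta>"
  shows "integrable (lebesgue_on \<Omega>) (\<lambda>x. u x * laplacian \<eta> x)"
    and "(LINT x:\<Omega>|lebesgue. g x \<bullet> grad \<eta> x) = - integral \<Omega> (\<lambda>x. u x * laplacian \<eta> x)"
proof -
  let ?M = "lebesgue_on \<Omega>"
  have lm: "\<Omega> \<in> lmeasurable"
    using \<Omega> by (simp add: lmeasurable_open)
  then have \<Omega>s: "\<Omega> \<in> sets lebesgue" by auto
  interpret finite_measure ?M
    by (rule finite_measure_lebesgue_on[OF lm])
  obtain \<phi> where t: "\<And>n. test_fun \<Omega> (\<phi> n)"
    and 0: "(\<lambda>n. \<integral>\<^sup>+ x\<in>\<Omega>. ennreal ((\<phi> n x - u x)^2) \<partial>lebesgue) \<longlonglongrightarrow> 0"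
    and 1: "(\<lambda>n. \<integral>\<^sup>+ x\<in>\<Omega>. ennreal ((norm (grad (\<phi> n) x - g x))^2) \<partial>lebesgue) \<longlonglongrightarrow> 0"
    using H unfolding H01_def H01_approx_def by blast
  have um: "u \<in> borel_measurable ?M" and gm: "g \<in> borel_measurable ?M"
    using H \<Omega>s unfolding H01_def set_borel_measurable_def
    by (auto simp: borel_measurable_restrict_space_iff)
  have meas: "f \<in> borel_measurable ?M" if "continuous_on UNIV f" for f :: "'a \<Rightarrow> 'b::euclidean_space"
    by (rule continuous_imp_measurable_on_sets_lebesgue[OF continuous_on_subset[OF that] \<Omega>s]) simp
  obtain T where T: "compact T" "\<And>x. x \<notin> T \<Longrightarrow> grad \<eta> x = 0" "\<And>x. x \<notin> T \<Longrightarrow> laplacian \<eta> x = 0"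
    using test_fun_support[OF \<eta>] by metis
  note sm = test_fun_smooth[OF \<eta>] test_fun_smooth[OF t]
  obtain B1 where B1: "B1 \<ge> 0" "\<And>x. norm (grad \<eta> x) \<le> B1"
    using compact_support_bounded[OF continuous_on_grad[OF sm(1)] T(1,2)] by metis
  obtain B0 where B0: "B0 \<ge> 0" "\<And>x. norm (laplacian \<eta> x) \<le> B0"
    using compact_support_bounded[OF continuous_on_laplacian[OF sm(1)] T(1,3)] by metis
  have int: "integrable ?M f" if c: "continuous_on UNIV f" and z: "\<And>x. x \<notin> T \<Longrightarrow> f x = 0" for f :: "'a \<Rightarrow> real"
  proof -
    obtain B where "\<And>x. norm (f x) \<le> B"
      using compact_support_bounded[OF c T(1) z] by metis
    then show ?thesis
      by (intro integrable_const_bound[of _ B] meas c) auto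
  qed
  have int0: "integrable ?M (\<lambda>x. \<phi> n x * laplacian \<eta> x)" for n
    by (intro int continuous_intros smooth_fun_continuous continuous_on_laplacian sm) (simp add: T)
  have int1: "integrable ?M (\<lambda>x. grad (\<phi> n) x \<bullet> grad \<eta> x)" for n
    by (intro int continuous_intros continuous_on_grad sm) (simp add: T)
  have L0: "(\<lambda>n. \<integral>\<^sup>+ x. ennreal ((norm (\<phi> n x - u x))\<^sup>2) \<partial>?M) \<longlonglongrightarrow> 0"
    using 0 \<Omega>s by (simp add: nn_integral_restrict_space)
  have L1: "(\<lambda>n. \<integral>\<^sup>+ x. ennreal ((norm (grad (\<phi> n) x - g x))\<^sup>2) \<partial>?M) \<longlonglongrightarrow> 0"
    using 1 \<Omega>s by (simp add: nn_integral_restrict_space)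
  note lim0 = tendsto_integral_inner_of_L2[OF finite_measure_lebesgue_on[OF lm]
      meas[OF smooth_fun_continuous[OF sm(2)]] um meas[OF continuous_on_laplacian[OF sm(1)]] L0 B0,
      unfolded inner_real_def, OF int0]
  note lim1 = tendsto_integral_inner_of_L2[OF finite_measure_lebesgue_on[OF lm]
      meas[OF continuous_on_grad[OF sm(2)]] gm meas[OF continuous_on_grad[OF sm(1)]] L1 B1 int1]
  show iu: "integrable ?M (\<lambda>x. u x * laplacian \<eta> x)"
    by (rule lim0)
  have "(\<integral>x. grad (\<phi> n) x \<bullet> grad \<eta> x \<partial>?M) = - (\<integral>x. \<phi> n x * laplacian \<eta> x \<partial>?M)" for n
  proof -
    have "(\<integral>x. grad (\<phi> n) x \<bullet> grad \<eta> x + \<phi> n x * laplacian \<eta> x \<partial>?M) =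
        integral \<Omega> (\<lambda>x. grad (\<phi> n) x \<bullet> grad \<eta> x + \<phi> n x * laplacian \<eta> x)"
      by (intro lebesgue_integral_eq_integral Bochner_Integration.integrable_add int0 int1 \<Omega>s)
    also have "\<dots> = 0"
      by (intro integral_unique has_integral_by_parts sm \<eta>)
    finally show ?thesis
      using int0 int1 by simp
  qed
  then have "(\<integral>x. g x \<bullet> grad \<eta> x \<partial>?M) = - (\<integral>x. u x * laplacian \<eta> x \<partial>?M)"
    using LIMSEQ_unique[OF lim1(2)] tendsto_minus[OF lim0(2)] by simp
  then show "(LINT x:\<Omega>|lebesgue. g x \<bullet> grad \<eta> x) = - integral \<Omega> (\<lambda>x. u x * laplacian \<eta> x)"
    using \<Omega>s by (simp add: set_lebesgue_integral_def integral_restrict_space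
        lebesgue_integral_eq_integral[OF iu, symmetric])
qed

section \<open>Radial bump functions\<close>

text \<open>For \<open>j = 0\<close> this is the classical smooth function exp(-1/t) extended by
  zero. Differentiation produces further negative powers of \<open>t\<close>, and the index
  \<open>j\<close> keeps track of them.\<close>

definition flat :: "nat \<Rightarrow> real \<Rightarrow> real" where
  "flat j t = (if 0 < t then exp (- (1 / t)) / t ^ j else 0)"

lemma flat_nonneg: "0 \<le> flat j t"
  by (simp add: flat_def)

lemma flat_pos: "0 < t \<Longrightarrow> 0 < flat j t"
  by (simp add: flat_def)

lemma flat_eq_0: "t \<le> 0 \<Longrightarrow> flat j t = 0"
  by (simp add: flat_def)

text \<open>From the right, s = 1/t turns the limit into that of s^j / exp s at infinity, where the
  exponential dominates.\<close>

lemma flat_tendsto_0: "(flat j \<longlongrightarrow> 0) (at 0)"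
proof (rule filterlim_split_at)
  have "(flat j \<longlongrightarrow> 0) (at_left 0) \<longleftrightarrow> ((\<lambda>_. 0 :: real) \<longlongrightarrow> 0) (at_left (0::real))"
    by (intro filterlim_cong eventually_at_leftI[of "-1"]) (auto simp: flat_def)
  then show "(flat j \<longlongrightarrow> 0) (at_left 0)" by simp
  have "((\<lambda>t. inverse t ^ j / exp (inverse t)) \<longlongrightarrow> (0::real)) (at_right 0)"
    by (rule filterlim_compose[OF tendsto_power_div_exp_0 filterlim_inverse_at_top_right])
  moreover have "(flat j \<longlongrightarrow> 0) (at_right 0) \<longleftrightarrow>
      ((\<lambda>t. inverse t ^ j / exp (inverse t)) \<longlongrightarrow> (0::real)) (at_right 0)"
    by (intro filterlim_cong eventually_at_rightI[of _ 1])
      (auto simp: flat_def exp_minus field_simps)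
  ultimately show "(flat j \<longlongrightarrow> 0) (at_right 0)" by simp
qed

text \<open>For positive \<open>t\<close> this is the quotient rule. At 0 the difference quotient of
  \<open>flat j\<close> is \<open>flat (j + 1)\<close>, which tends to 0.\<close>

lemma flat_deriv:
  "(flat j has_real_derivative flat (j + 2) t - real j * flat (j + 1) t) (at t)"
proof (cases t "0::real" rule: linorder_cases)
  case less
  have "((\<lambda>_. 0) has_real_derivative 0) (at t)" by simp
  then have "(flat j has_real_derivative 0) (at t)"
    by (rule has_field_derivative_transform_within_open[where S="{..<0}"])
      (use less in \<open>auto simp: flat_def\<close>)
  then show ?thesis
    using less by (simp add: flat_eq_0)
next
  case equal
  have "((\<lambda>y. (flat j y - flat j 0) / (y - 0)) \<longlongrightarrow> 0) (at 0) \<longleftrightarrow> (flat (j + 1) \<longlongrightarrow> 0) (at 0)"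
    by (intro filterlim_cong eventually_at_topological[THEN iffD2] exI[of _ UNIV])
      (auto simp: flat_def field_simps)
  then show ?thesis
    using flat_tendsto_0[of "j + 1"] by (simp add: equal has_field_derivative_iff flat_eq_0)
next
  case greater
  have "((\<lambda>t. exp (- (1 / t)) / t ^ j) has_real_derivative
      (exp (- (1 / t)) * (1 / t\<^sup>2) * t ^ j - exp (- (1 / t)) * (real j * t ^ (j - 1))) / (t ^ j * t ^ j)) (at t)"
    using greater by (auto intro!: derivative_eq_intros simp: power2_eq_square)
  moreover have "(exp (- (1 / t)) * (1 / t\<^sup>2) * t ^ j - exp (- (1 / t)) * (real j * t ^ (j - 1))) / (t ^ j * t ^ j)
      = flat (j + 2) t - real j * flat (j + 1) t"
    using greater by (cases j) (auto simp: flat_def field_simps power2_eq_square)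
  ultimately have "((\<lambda>t. exp (- (1 / t)) / t ^ j) has_real_derivative
      flat (j + 2) t - real j * flat (j + 1) t) (at t)"
    by simp
  then show ?thesis
    by (rule has_field_derivative_transform_within_open[where S="{0<..}"])
      (use greater in \<open>auto simp: flat_def\<close>)
qed

lemma continuous_on_flat [continuous_intros]:
  assumes "continuous_on S f"
  shows "continuous_on S (\<lambda>x. flat j (f x))"
proof -
  have "continuous_on UNIV (flat j)"
    by (rule DERIV_continuous_on) (rule has_field_derivative_at_within[OF flat_deriv])
  then show ?thesis
    by (rule continuous_on_compose2[OF _ assms]) simp
qed

text \<open>Using the squared norm keeps the radial function smooth at its centre \<open>c\<close>.
  For positive \<open>r\<close> it is supported in the closed ball of radius
  \<open>r\<close>.\<close>

definition bump :: "'a::euclidean_space \<Rightarrow> real \<Rightarrow> nat \<Rightarrow> 'a \<Rightarrow> real" where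
  "bump c r j x = flat j (1 - (norm (x - c))\<^sup>2 / r\<^sup>2)"

lemma bump_nonneg: "0 \<le> bump c r j x"
  by (simp add: bump_def flat_nonneg)

lemma bump_pos: "norm (x - c) < r \<Longrightarrow> 0 < bump c r j x"
  unfolding bump_def by (intro flat_pos) (simp add: divide_less_eq power_strict_mono)

lemma bump_eq_0: "0 < r \<Longrightarrow> r \<le> norm (x - c) \<Longrightarrow> bump c r j x = 0"
  unfolding bump_def by (intro flat_eq_0) (simp add: le_divide_eq power_mono)

text \<open>The chain rule with \<open>flat_deriv\<close>. Differences are written as sums with
  negated constants so that the result is built literally from constants, inner products, bumps,
  sums and products.\<close>

lemma bump_has_derivative:
  "(bump c r j has_derivative (\<lambda>h. (bump c r (j + 2) x + - real j * bump c r (j + 1) x) *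
      (- 2 / r\<^sup>2 * (x \<bullet> h + - (c \<bullet> h))))) (at x)"
proof -
  have "((\<lambda>x. 1 - ((x - c) \<bullet> (x - c)) * inverse (r\<^sup>2)) has_derivative (\<lambda>h. - 2 / r\<^sup>2 * (x \<bullet> h + - (c \<bullet> h)))) (at x)"
    by (auto intro!: derivative_eq_intros simp: fun_eq_iff inner_diff_left inner_diff_right
        inner_commute divide_inverse algebra_simps)
  then have "((\<lambda>x. 1 - (norm (x - c))\<^sup>2 / r\<^sup>2) has_derivative (\<lambda>h. - 2 / r\<^sup>2 * (x \<bullet> h + - (c \<bullet> h)))) (at x)"
    by (simp only: power2_norm_eq_inner divide_inverse)
  from has_derivative_compose[OF this flat_deriv[unfolded has_field_derivative_def]]
  show ?thesis
    unfolding bump_def by simp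
qed

text \<open>The algebra generated by the functions \<open>bump c r j\<close> and the affine functions is closed
  under partial derivatives, so that all its members are smooth.\<close>

inductive bump_algebra :: "'a::euclidean_space \<Rightarrow> real \<Rightarrow> ('a \<Rightarrow> real) \<Rightarrow> bool" for c r where
  const: "bump_algebra c r (\<lambda>_. k)"
| inner: "bump_algebra c r (\<lambda>x. x \<bullet> b)"
| bump: "bump_algebra c r (bump c r j)"
| add: "bump_algebra c r f \<Longrightarrow> bump_algebra c r g \<Longrightarrow> bump_algebra c r (\<lambda>x. f x + g x)"
| mult: "bump_algebra c r f \<Longrightarrow> bump_algebra c r g \<Longrightarrow> bump_algebra c r (\<lambda>x. f x * g x)"

lemma bump_algebra_derivative:
  "bump_algebra c r f \<Longrightarrow>
    \<exists>f'. (\<forall>x. (f has_derivative f' x) (at x)) \<and> (\<forall>b. bump_algebra c r (\<lambda>x. f' x b))"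
proof (induction rule: bump_algebra.induct)
  case (const k)
  show ?case
    by (rule exI[of _ "\<lambda>_ _. 0"]) (auto intro: bump_algebra.const)
next
  case (inner b)
  show ?case
    by (rule exI[of _ "\<lambda>_ h. h \<bullet> b"])
      (auto intro!: bump_algebra.const derivative_eq_intros)
next
  case (bump j)
  show ?case
    by (rule exI, intro conjI allI, rule bump_has_derivative)
      (intro bump_algebra.intros)
next
  case (add f g)
  then obtain f' g' where *: "\<forall>x. (f has_derivative f' x) (at x)" "\<forall>b. bump_algebra c r (\<lambda>x. f' x b)"
    "\<forall>x. (g has_derivative g' x) (at x)" "\<forall>b. bump_algebra c r (\<lambda>x. g' x b)" by blast
  then show ?case
    by (intro exI[of _ "\<lambda>x h. f' x h + g' x h"] conjI allI has_derivative_add bump_algebra.add) auto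
next
  case (mult f g)
  then obtain f' g' where *: "\<forall>x. (f has_derivative f' x) (at x)" "\<forall>b. bump_algebra c r (\<lambda>x. f' x b)"
    "\<forall>x. (g has_derivative g' x) (at x)" "\<forall>b. bump_algebra c r (\<lambda>x. g' x b)" by blast
  then show ?case
    using mult.hyps
    by (intro exI[of _ "\<lambda>x h. f x * g' x h + f' x h * g x"] conjI allI has_derivative_mult
        bump_algebra.add bump_algebra.mult) auto
qed

text \<open>The algebra itself is the coinduction invariant: by uniqueness of the derivative,
  \<open>pd b f\<close> is the member supplied by \<open>bump_algebra_derivative\<close>.\<close>

lemma bump_algebra_smooth: "bump_algebra c r f \<Longrightarrow> smooth_fun f"
proof (coinduction arbitrary: f)
  case smooth_fun
  then obtain f' where f': "\<And>x. (f has_derivative f' x) (at x)" "\<And>b. bump_algebra c r (\<lambda>x. f' x b)"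
    using bump_algebra_derivative by metis
  have "pd b f = (\<lambda>x. f' x b)" for b
    using frechet_derivative_at[OF f'(1)] by auto
  then show ?case
    using f' by (auto simp: differentiable_def intro!: exI)
qed

lemma bump_smooth: "smooth_fun (bump c r j)"
  by (rule bump_algebra_smooth[of c r]) (rule bump_algebra.bump)

lemma bump_test_fun:
  assumes "0 < r" "cball c r \<subseteq> \<Omega>"
  shows "test_fun \<Omega> (bump c r j)"
proof -
  have "{x. bump c r j x \<noteq> 0} \<subseteq> cball c r"
    using bump_eq_0[OF assms(1)] by (force simp: dist_norm norm_minus_commute)
  then have "closure {x. bump c r j x \<noteq> 0} \<subseteq> cball c r"
    by (intro closure_minimal) auto
  then show ?thesis
    using assms unfolding test_fun_def
    by (auto simp: bump_smooth compact_eq_bounded_closed intro: bounded_subset)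
qed

text \<open>The chain rule applied twice: the derivative of \<open>flat 0\<close> is
  \<open>flat 2\<close>, and that of \<open>flat 2\<close> is \<open>flat 4 - 2 * flat 3\<close>.
  Summing over the basis turns squared coordinates into the squared norm and the constant term into
  the dimension.\<close>

lemma laplacian_bump:
  fixes c :: "'a::euclidean_space"
  shows "laplacian (bump c r 0) x =
    (bump c r 4 x - 2 * bump c r 3 x) * (4 / r ^ 4 * (norm (x - c))\<^sup>2)
      - 2 / r\<^sup>2 * real DIM('a) * bump c r 2 x"
proof -
  have pd1: "pd b (bump c r 0) = (\<lambda>x. bump c r 2 x * (- 2 / r\<^sup>2 * ((x - c) \<bullet> b)))" for b
    using frechet_derivative_at[OF bump_has_derivative[of c r 0], symmetric]
    by (simp add: fun_eq_iff inner_diff_left numeral_2_eq_2)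
  have pd2: "pd b (pd b (bump c r 0)) x =
      (bump c r 4 x - 2 * bump c r 3 x) * (4 / r ^ 4 * ((x - c) \<bullet> b)\<^sup>2) - 2 / r\<^sup>2 * bump c r 2 x"
    if "b \<in> Basis" for b
  proof -
    have "((\<lambda>x. - 2 / r\<^sup>2 * ((x - c) \<bullet> b)) has_derivative (\<lambda>h. - 2 / r\<^sup>2 * (h \<bullet> b))) (at x)"
      by (rule has_derivative_mult_right) (auto intro!: derivative_eq_intros)
    from frechet_derivative_at[OF has_derivative_mult[OF bump_has_derivative[of c r 2 x] this]]
    have "pd b (pd b (bump c r 0)) x = bump c r 2 x * (- 2 / r\<^sup>2 * (b \<bullet> b)) +
      (bump c r (2 + 2) x + - real 2 * bump c r (2 + 1) x) *
      (- 2 / r\<^sup>2 * (x \<bullet> b + - (c \<bullet> b))) * (- 2 / r\<^sup>2 * ((x - c) \<bullet> b))"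
      unfolding pd1 by (simp only: fun_eq_iff)
    moreover have "b \<bullet> b = 1" "x \<bullet> b + - (c \<bullet> b) = (x - c) \<bullet> b"
      "2 + 2 = (4::nat)" "2 + 1 = (3::nat)" "real 2 = 2"
      using that by (simp_all add: inner_diff_left)
    \<comment> \<open>For \<open>r = 0\<close> both sides vanish by the convention on division by
      zero.\<close>
    moreover have "C * (- 2 / r\<^sup>2 * 1) + (A + - 2 * B) * (- 2 / r\<^sup>2 * X) * (- 2 / r\<^sup>2 * X) =
        (A - 2 * B) * (4 / r ^ 4 * X\<^sup>2) - 2 / r\<^sup>2 * C" for A B C X :: real
      by (cases "r = 0") (simp_all add: power2_eq_square power4_eq_xxxx field_simps)
    ultimately show ?thesis
      by (simp only:)
  qed
  have "(norm (x - c))\<^sup>2 = (\<Sum>b\<in>Basis. ((x - c) \<bullet> b)\<^sup>2)"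
    unfolding power2_norm_eq_inner by (subst euclidean_inner) (simp add: power2_eq_square)
  then show ?thesis
    by (simp add: laplacian_def pd2 sum_subtractf sum_distrib_left)
qed

section \<open>The strong maximum principle\<close>

text \<open>With d the dimension, scaling gives that the radius derivative of the kernel is -1/(r *
  r^d) times the divergence of \<open>(x - c) * bump c r 2 x\<close>. That field is -r^2/2 times the
  gradient of \<open>bump c r 0\<close>, so a positive multiple of a Laplacian results.\<close>

lemma bump_radius_derivative:
  fixes c :: "'a::euclidean_space"
  assumes "0 < r"
  shows "((\<lambda>r. bump c r 2 x / r ^ DIM('a)) has_real_derivative
    r / (2 * r ^ DIM('a)) * laplacian (bump c r 0) x) (at r)"
proof -
  \<comment> \<open>Naming the predecessor of the dimension avoids truncated subtraction in the
    exponent.\<close>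
  obtain d where d: "DIM('a) = Suc d"
    using DIM_positive[where 'a='a] by (cases "DIM('a)") auto
  let ?N = "(norm (x - c))\<^sup>2"
  have "((\<lambda>r. 1 - ?N / r\<^sup>2) has_real_derivative 2 * ?N / r ^ 3) (at r)"
    using assms by (auto intro!: derivative_eq_intros simp: power2_eq_square power3_eq_cube field_simps)
  from DERIV_chain2[OF flat_deriv[of 2] this]
  have "((\<lambda>r. bump c r 2 x) has_real_derivative
      (bump c r 4 x - 2 * bump c r 3 x) * (2 * ?N / r ^ 3)) (at r)"
    by (simp add: bump_def numeral_eq_Suc)
  moreover have "((\<lambda>r. r ^ DIM('a)) has_real_derivative real (Suc d) * r ^ d) (at r)"
    unfolding d using DERIV_pow[of "Suc d" r] by simp
  ultimately have "((\<lambda>r. bump c r 2 x / r ^ DIM('a)) has_real_derivative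
      ((bump c r 4 x - 2 * bump c r 3 x) * (2 * ?N / r ^ 3) * r ^ DIM('a)
        - bump c r 2 x * (real (Suc d) * r ^ d)) / (r ^ DIM('a) * r ^ DIM('a))) (at r)"
    using assms by (intro DERIV_divide) auto
  moreover have "((bump c r 4 x - 2 * bump c r 3 x) * (2 * ?N / r ^ 3) * r ^ DIM('a)
        - bump c r 2 x * (real (Suc d) * r ^ d)) / (r ^ DIM('a) * r ^ DIM('a))
      = r / (2 * r ^ DIM('a)) * laplacian (bump c r 0) x"
  proof -
    have "((A - 2 * B) * (2 * N / r ^ 3) * r ^ Suc d - C * (D * r ^ d)) / (r ^ Suc d * r ^ Suc d)
      = r / (2 * r ^ Suc d) * ((A - 2 * B) * (4 / r ^ 4 * N) - 2 / r\<^sup>2 * D * C)" for A B C D N :: real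
      using assms by (simp add: field_simps eval_nat_numeral)
    then show ?thesis
      unfolding laplacian_bump d .
  qed
  ultimately show ?thesis by simp
qed

text \<open>Weighted means of \<open>w\<close> around \<open>c\<close> are squeezed between 0 and
  their limit 0 at small radii. Cubes replace balls as domains of integration, since differentiation
  under the integral and the volume formula are applied on boxes.\<close>

lemma superharmonic_zero_near:
  fixes \<Omega> :: "'a::euclidean_space set"
  assumes \<Omega>: "open \<Omega>" and w: "continuous_on \<Omega> w" "\<And>x. x \<in> \<Omega> \<Longrightarrow> 0 \<le> w x"
    and super: "\<And>\<eta>. test_fun \<Omega> \<eta> \<Longrightarrow> (\<And>x. 0 \<le> \<eta> x) \<Longrightarrow>
      integral \<Omega> (\<lambda>x. w x * laplacian \<eta> x) \<le> 0"
    and c: "c \<in> \<Omega>" "w c = 0"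
  obtains r where "0 < r" "\<And>x. x \<in> ball c r \<Longrightarrow> x \<in> \<Omega> \<and> w x = 0"
proof -
  let ?d = "DIM('a)"
  let ?Q = "\<lambda>r. cbox (c - r *\<^sub>R One) (c + r *\<^sub>R One)"
  have QB: "norm (x - c) \<le> real ?d * r" if "x \<in> ?Q r" for x r
  proof -
    have "norm (x - c) \<le> (\<Sum>b\<in>Basis. \<bar>(x - c) \<bullet> b\<bar>)"
      by (rule norm_le_l1)
    also have "\<dots> \<le> (\<Sum>b\<in>(Basis::'a set). r)"
      using that by (intro sum_mono) (auto simp: mem_box inner_diff_left inner_add_left abs_le_iff algebra_simps)
    finally show ?thesis by simp
  qed
  have BQ: "x \<in> ?Q r" if "norm (x - c) \<le> r" for x r
  proof -
    have "\<bar>(x - c) \<bullet> b\<bar> \<le> r" if "b \<in> Basis" for b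
      using Basis_le_norm[OF that, of "x - c"] \<open>norm (x - c) \<le> r\<close> by simp
    then show ?thesis
      by (fastforce simp: mem_box inner_diff_left inner_add_left abs_le_iff algebra_simps)
  qed
  obtain R where R: "0 < R" "cball c R \<subseteq> \<Omega>"
    using open_contains_cball_eq[OF \<Omega>] c by blast
  \<comment> \<open>A cube of half-side \<open>\<rho>\<close> lies in the ball of radius
    \<open>DIM('a) * \<rho>\<close>, which is \<open>R\<close>.\<close>
  define \<rho> where "\<rho> = R / real ?d"
  have \<rho>: "0 < \<rho>"
    using R by (simp add: \<rho>_def)
  have Q\<Omega>: "?Q \<rho> \<subseteq> \<Omega>"
  proof
    fix x assume "x \<in> ?Q \<rho>"
    then have "x \<in> cball c R"
      using QB[of x \<rho>] by (simp add: \<rho>_def dist_norm norm_minus_commute)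
    then show "x \<in> \<Omega>" using R by blast
  qed
  have wQ: "continuous_on (?Q \<rho>) w"
    using w(1) Q\<Omega> by (rule continuous_on_subset)
  have bump_out: "bump c r j x = 0" if "x \<notin> ?Q s" "0 < r" "r \<le> s" for x r s j
    using BQ[of x s] that by (intro bump_eq_0) linarith+
  \<comment> \<open>The domain is the same cube for every radius, so only the integrand depends on
    \<open>r\<close>. The power of \<open>r\<close> keeps the mass of the kernel constant for
    \<open>r\<close> up to \<open>\<rho>\<close>.\<close>
  define m where "m r = integral (?Q \<rho>) (\<lambda>x. w x * (bump c r 2 x / r ^ ?d))" for r
  define m' where "m' r = integral (?Q \<rho>) (\<lambda>x. w x * (r / (2 * r ^ ?d) * laplacian (bump c r 0) x))" for r
  have cont_bump: "continuous_on S (bump c r j)" for S r j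
    by (rule smooth_fun_continuous[OF bump_smooth])
  have int_m: "(\<lambda>x. w x * (bump c r 2 x / r ^ ?d)) integrable_on ?Q \<rho>" if "0 < r" for r
    using that by (intro integrable_continuous continuous_intros wQ cont_bump) auto
  have m_deriv: "(m has_real_derivative m' r) (at r)" if "0 < r" for r
  proof -
    have m_eq: "m = (\<lambda>r. integral (?Q \<rho>) (\<lambda>x. w x * (bump c r 2 x / r ^ ?d)))"
      by (rule ext) (rule m_def)
    have "(m has_real_derivative m' r) (at r within {0<..})"
      unfolding m_eq m'_def
    proof (rule leibniz_rule_field_derivative[where f="\<lambda>r x. w x * (bump c r 2 x / r ^ ?d)"
          and fx="\<lambda>r x. w x * (r / (2 * r ^ ?d) * laplacian (bump c r 0) x)"])
      show "((\<lambda>r. w x * (bump c r 2 x / r ^ ?d)) has_real_derivative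
          w x * (r / (2 * r ^ ?d) * laplacian (bump c r 0) x)) (at r within {0<..})"
        if "r \<in> {0<..}" for r x
        using that
        by (intro has_field_derivative_at_within[OF DERIV_cmult[OF bump_radius_derivative]]) simp
      have "continuous_on ({0<..} \<times> ?Q \<rho>) (\<lambda>p. w (snd p))"
        by (intro continuous_on_compose2[OF wQ] continuous_intros) auto
      \<comment> \<open>Joint continuity in radius and point is read off from the explicit formula,
        with \<open>r\<close> kept positive.\<close>
      then show "continuous_on ({0<..} \<times> ?Q \<rho>)
          (\<lambda>(r, x). w x * (r / (2 * r ^ ?d) * laplacian (bump c r 0) x))"
        unfolding case_prod_unfold laplacian_bump unfolding bump_def
        by (intro continuous_intros) auto
    qed (use int_m that in auto)
    then show ?thesis
      using that by (subst (asm) at_within_open) auto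
  qed
  \<comment> \<open>For these radii \<open>bump c r 0\<close> is an admissible nonnegative test
    function, and its Laplacian vanishes off the cube.\<close>
  have m'_nonpos: "m' r \<le> 0" if r: "0 < r" "r \<le> \<rho>" for r
  proof -
    have "cball c r \<subseteq> \<Omega>"
      using BQ Q\<Omega> r by (force simp: dist_norm norm_minus_commute)
    then have t: "test_fun \<Omega> (bump c r 0)"
      by (rule bump_test_fun[OF r(1)])
    have "laplacian (bump c r 0) x = 0" if "x \<notin> ?Q \<rho>" for x
      using bump_out[OF that r] by (simp add: laplacian_bump)
    then have "integral \<Omega> (\<lambda>x. w x * laplacian (bump c r 0) x) =
        integral (?Q \<rho>) (\<lambda>x. w x * laplacian (bump c r 0) x)"
      using Q\<Omega> by (intro integral_spike_set negligible_subset[OF negligible_empty]) auto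
    moreover have "m' r = r / (2 * r ^ ?d) * integral (?Q \<rho>) (\<lambda>x. w x * laplacian (bump c r 0) x)"
      unfolding m'_def integral_mult_right[symmetric] by (simp add: mult_ac)
    ultimately show ?thesis
      using super[OF t bump_nonneg] r
      by (simp only:) (rule mult_nonneg_nonpos, auto)
  qed
  have mono: "m s \<le> m r" if "0 < r" "r \<le> s" "s \<le> \<rho>" for r s
  proof (rule DERIV_nonpos_imp_nonincreasing[OF that(2)])
    fix t assume "r \<le> t" "t \<le> s"
    then have "0 < t" "t \<le> \<rho>" using that by auto
    then show "\<exists>y. (m has_real_derivative y) (at t) \<and> y \<le> 0"
      using m_deriv m'_nonpos by blast
  qed
  obtain B where B: "0 \<le> B" "\<And>t. t \<in> {0..1} \<Longrightarrow> flat 2 t \<le> B"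
  proof -
    have "compact (flat 2 ` {0..1})"
      by (intro compact_continuous_image continuous_intros) auto
    then obtain B where "\<And>t. t \<in> {0..1} \<Longrightarrow> norm (flat 2 t) \<le> B"
      by (force simp: bounded_iff dest: compact_imp_bounded)
    then show ?thesis
      using that[of "max B 0"] by force
  qed
  have bump_le: "bump c r 2 x \<le> B" for r x
  proof (cases "1 - (norm (x - c))\<^sup>2 / r\<^sup>2 \<ge> 0")
    case True
    then show ?thesis
      unfolding bump_def by (intro B) auto
  next
    case False
    then show ?thesis
      unfolding bump_def using B by (simp add: flat_eq_0)
  qed
  \<comment> \<open>On a small cube \<open>w\<close> is at most \<open>e\<close> and the kernel at
    most \<open>B / r ^ ?d\<close>. The volume \<open>(2 * r) ^ ?d\<close> cancels the power of
    \<open>r\<close>, so the bound survives up to radius \<open>\<rho>\<close> by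
    monotonicity.\<close>
  have small: "m \<rho> \<le> e * (B * 2 ^ ?d)" if e: "0 < e" for e
  proof -
    obtain \<delta> where \<delta>: "0 < \<delta>" "\<And>x. x \<in> \<Omega> \<Longrightarrow> dist x c < \<delta> \<Longrightarrow> dist (w x) (w c) < e"
      using w(1) c(1) e unfolding continuous_on_iff by blast
    \<comment> \<open>The second entry places the cube in the ball of radius
      \<open>\<delta> / 2\<close>.\<close>
    define r where "r = min \<rho> (\<delta> / (2 * real ?d))"
    have r: "0 < r" "r \<le> \<rho>"
      using \<rho> \<delta> by (auto simp: r_def)
    have Qr: "?Q r \<subseteq> ?Q \<rho>"
      using r by (intro subset_box_imp) (auto simp: inner_diff_left inner_add_left)
    have "m r = integral (?Q r) (\<lambda>x. w x * (bump c r 2 x / r ^ ?d))"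
      unfolding m_def using bump_out[of _ r r 2] r Qr
      by (intro integral_spike_set negligible_subset[OF negligible_empty]) auto
    also have "\<dots> \<le> integral (?Q r) (\<lambda>_. e * (B / r ^ ?d))"
    proof (rule integral_le)
      show "(\<lambda>x. w x * (bump c r 2 x / r ^ ?d)) integrable_on ?Q r"
        using int_m[OF r(1)] Qr by (rule integrable_on_subcbox)
      fix x assume x: "x \<in> ?Q r"
      have "norm (x - c) \<le> real ?d * r" by (rule QB[OF x])
      also have "\<dots> \<le> real ?d * (\<delta> / (2 * real ?d))"
        by (intro mult_left_mono) (auto simp: r_def)
      also have "\<dots> < \<delta>" using \<delta>(1) by simp
      finally have "dist (w x) (w c) < e"
        using x Qr Q\<Omega> by (intro \<delta>) (auto simp: dist_norm)
      then have "w x \<le> e" using c(2) by (simp add: dist_real_def)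
      then show "w x * (bump c r 2 x / r ^ ?d) \<le> e * (B / r ^ ?d)"
        using r e bump_le bump_nonneg by (intro mult_mono divide_right_mono divide_nonneg_nonneg) auto
    qed auto
    also have "\<dots> = e * (B * 2 ^ ?d)"
    proof -
      have "measure lborel (?Q r) = (\<Prod>i\<in>(Basis::'a set). 2 * r)"
        using r by (subst content_cbox) (auto simp: inner_diff_left inner_add_left intro!: prod.cong)
      then show ?thesis
        using r by (simp add: power_mult_distrib)
    qed
    finally show ?thesis
      using mono[of r \<rho>] r by simp
  qed
  have "m \<rho> \<le> 0"
  proof (rule field_le_epsilon)
    fix e :: real assume e: "0 < e"
    define K where "K = B * 2 ^ ?d"
    have K: "0 \<le> K" using B(1) by (simp add: K_def)
    \<comment> \<open>Dividing by \<open>K + 1\<close> also covers the case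
      \<open>K = 0\<close>.\<close>
    have "m \<rho> \<le> e / (K + 1) * K"
      unfolding K_def by (rule small) (use e K in \<open>simp add: K_def[symmetric]\<close>)
    also have "\<dots> \<le> e"
      using K e by (simp add: pos_divide_le_eq)
    finally show "m \<rho> \<le> 0 + e" by simp
  qed
  moreover have nn: "0 \<le> w x * (bump c \<rho> 2 x / \<rho> ^ ?d)" if "x \<in> ?Q \<rho>" for x
    using that w(2) Q\<Omega> \<rho> bump_nonneg by (intro mult_nonneg_nonneg divide_nonneg_nonneg) auto
  then have "0 \<le> m \<rho>"
    unfolding m_def by (intro integral_nonneg int_m \<rho>) auto
  ultimately have "((\<lambda>x. w x * (bump c \<rho> 2 x / \<rho> ^ ?d)) has_integral 0) (?Q \<rho>)"
    using int_m[OF \<rho>] by (simp add: m_def has_integral_iff)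
  \<comment> \<open>A continuous nonnegative function with zero integral over a nondegenerate box
    vanishes on it.\<close>
  then have zero: "w x * (bump c \<rho> 2 x / \<rho> ^ ?d) = 0" if "x \<in> ?Q \<rho>" for x
  proof (rule has_integral_0_cbox_imp_0[rotated 2])
    show "continuous_on (?Q \<rho>) (\<lambda>x. w x * (bump c \<rho> 2 x / \<rho> ^ ?d))"
      using \<rho> by (intro continuous_intros wQ cont_bump) auto
    show "box (c - \<rho> *\<^sub>R One) (c + \<rho> *\<^sub>R One) \<noteq> {}"
      using \<rho> by (auto simp: box_ne_empty inner_diff_left inner_add_left)
  qed (use nn that box_subset_cbox in auto)
  show ?thesis
  proof (rule that[OF \<rho>])
    fix x assume "x \<in> ball c \<rho>"
    then have n: "norm (x - c) < \<rho>" by (simp add: dist_norm norm_minus_commute)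
    then have x: "x \<in> ?Q \<rho>" by (intro BQ) simp
    then show "x \<in> \<Omega> \<and> w x = 0"
      using zero[OF x] bump_pos[OF n, of 2] \<rho> Q\<Omega> by auto
  qed
qed

theorem theorem3p5:
  fixes \<Omega> :: "'a::euclidean_space set" and \<mu> :: "'a measure" and u :: "'a \<Rightarrow> real"
  assumes "open \<Omega>" and "connected \<Omega>" and "bounded \<Omega>" and "\<Omega> \<noteq> {}"
    and "sets \<mu> = sets borel" and "finite_measure \<mu>"
    and "measure_support \<mu> \<subseteq> closure \<Omega>" and "emeasure \<mu> \<Omega> > 0"
    and "MPI \<Omega> \<mu>"
    and "continuous_on \<Omega> u"
    and "\<not> (\<exists>c. \<forall>x\<in>\<Omega>. u x = c)"
    and "mu_subharmonic \<Omega> \<mu> u"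
  shows "\<not> (\<exists>x\<in>\<Omega>. \<forall>y\<in>\<Omega>. u y \<le> u x)"
proof
  assume "\<exists>x\<in>\<Omega>. \<forall>y\<in>\<Omega>. u y \<le> u x"
  then obtain x0 where x0: "x0 \<in> \<Omega>" "\<And>y. y \<in> \<Omega> \<Longrightarrow> u y \<le> u x0" by blast
  obtain f g where H: "H01 \<Omega> u g" and f: "AE x in \<mu>. - f x \<ge> 0"
    and eq: "\<And>\<phi>. test_fun \<Omega> \<phi> \<Longrightarrow>
      (LINT x:\<Omega>|lebesgue. g x \<bullet> grad \<phi> x) = (\<integral>x. f x * \<phi> x \<partial>\<mu>)"
    using assms(12) unfolding mu_subharmonic_def minus_laplacian_mu_def N_perp_def by blast
  have \<Omega>s: "\<Omega> \<in> sets lebesgue"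
    using assms(1) by (simp add: borel_open)
  \<comment> \<open>Testing the equation with \<open>\<eta>\<close> gives a nonpositive right-hand
    side, while the left-hand side is minus the integral of \<open>u * laplacian \<eta>\<close>.
    Subtracting \<open>u\<close> from the constant \<open>u x0\<close> reverses the sign.\<close>
  have super: "integral \<Omega> (\<lambda>x. (u x0 - u x) * laplacian \<eta> x) \<le> 0"
    if \<eta>: "test_fun \<Omega> \<eta>" and nn: "\<And>x. 0 \<le> \<eta> x" for \<eta>
  proof -
    have "0 \<le> (\<integral>x. - f x * \<eta> x \<partial>\<mu>)"
      using f by (intro integral_nonneg_AE) (auto simp: nn mult_nonpos_nonneg)
    then have "0 \<le> integral \<Omega> (\<lambda>x. u x * laplacian \<eta> x)"
      using eq[OF \<eta>] H01_weak_laplacian(2)[OF assms(1,3) H \<eta>] by simp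
    moreover have "(\<lambda>x. u x * laplacian \<eta> x) integrable_on \<Omega>"
      using has_integral_integral_lebesgue_on[OF H01_weak_laplacian(1)[OF assms(1,3) H \<eta>] \<Omega>s]
      by (rule has_integral_integrable)
    then have "((\<lambda>x. u x0 * laplacian \<eta> x - u x * laplacian \<eta> x) has_integral
        (u x0 * 0 - integral \<Omega> (\<lambda>x. u x * laplacian \<eta> x))) \<Omega>"
      by (intro has_integral_diff has_integral_mult_right has_integral_laplacian \<eta> integrable_integral)
    then have "integral \<Omega> (\<lambda>x. (u x0 - u x) * laplacian \<eta> x) = - integral \<Omega> (\<lambda>x. u x * laplacian \<eta> x)"
      by (simp add: left_diff_distrib integral_unique)
    ultimately show ?thesis by simp
  qed
  have "open {x \<in> \<Omega>. u x = u x0}"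
    unfolding open_contains_ball
  proof
    fix c assume c: "c \<in> {x \<in> \<Omega>. u x = u x0}"
    obtain r where "0 < r" "\<And>x. x \<in> ball c r \<Longrightarrow> x \<in> \<Omega> \<and> u x0 - u x = 0"
    proof (rule superharmonic_zero_near[OF assms(1), of "\<lambda>x. u x0 - u x" c])
      show "continuous_on \<Omega> (\<lambda>x. u x0 - u x)"
        by (intro continuous_intros assms)
    qed (use x0 c super in auto)
    then show "\<exists>e>0. ball c e \<subseteq> {x \<in> \<Omega>. u x = u x0}"
      by (intro exI[of _ r]) auto
  qed
  \<comment> \<open>The level set is open, relatively closed by continuity of \<open>u\<close>, and
    contains \<open>x0\<close>; connectedness makes it all of \<Omega>.\<close>
  then have "\<forall>x\<in>\<Omega>. u x = u x0"
    by (intro continuous_levelset_open[OF assms(2,10)] bexI[OF _ x0(1)]) auto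
  with assms(11) show False by blast
qed

end
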